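(* Let $p,q,d,k_\Sigma,k_\Omega,k$ be positive integers, $\varepsilon,\delta\in(0,1)$, $\mathbb K\in\{\mathbb R,\mathbb C\}$, $\eta_{\mathbb R}=1$, $\eta_{\mathbb C}=2$, and set $$\varepsilon':=\varepsilon/5,\qquad \delta':=\delta\,\big\lceil 25200\,\varepsilon^{-2}\big(6.9\,\eta_{\mathbb K}d+\log(24/\delta)\big)\big\rceil^{-1}.$$ Let $\Sigma\in\mathbb R^{k_\Sigma\times p}$ be a $(\varepsilon',\delta',d)$ oblivious $\mathbb R^p\to\mathbb R^{k_\Sigma}$ subspace embedding, let $\Omega\in\mathbb R^{k_\Omega\times q}$ be a $(\varepsilon',\delta',d)$ oblivious $\mathbb R^q\to\mathbb R^{k_\Omega}$ subspace embedding, and let $\Gamma\in\mathbb R^{k\times k_\Sigma k_\Omega}$ be a $(\varepsilon/4,\delta/3,d)$ oblivious $\mathbb R^{k_\Sigma k_\Omega}\to\mathbb R^k$ subspace embedding, with $\Sigma,\Omega,\Gamma$ independent. Then $\Upsilon:\mathbb R^{q\times p}\to\mathbb R^k$, $\Upsilon(X):=\Gamma\,\mathrm{vec}(\Omega X\Sigma^* )$, is a $(\varepsilon,\delta,d)$ oblivious $\mathbb R^{q\times p}\to\mathbb R^k$ subspace embedding.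
   Context: $M^*$ is the (conjugate) transpose and $\mathrm{vec}$ stacks the columns of a matrix into a vector. $\mathbb R^n$ carries its canonical inner product and $\mathbb R^{q\times p}$ the Frobenius inner product $\langle X,Y\rangle_F=\mathrm{Tr}(X^*Y)$. For a finite-dimensional real inner product space $Z$, a random linear map $\Theta:Z\to\mathbb R^k$ (a random matrix being identified with the linear map it defines) is called a $(\varepsilon,\delta,d)$ oblivious $Z\to\mathbb R^k$ subspace embedding if for every (deterministic) subspace $Z_d\subset Z$ with $\dim Z_d=d$, $$\mathbb P\big(\forall x,y\in Z_d:\ |\langle x,y\rangle_Z-\langle\Theta(x),\Theta(y)\rangle_2|\le\varepsilon\|x\|_Z\|y\|_Z\big)\ge 1-\delta .$$ This notion is only considered for $1\le d\le\dim Z$, for every embedding appearing in the statement. *)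

theory Defs
  imports "HOL-Probability.Probability"
begin

text \<open>A $q \times p$ real matrix has type \<^typ>\<open>real^'p^'q\<close>. The library's inner product on
  this type is the Frobenius inner product, so it can be used directly as the ambient inner
  product space.\<close>

lemma inner_matrix_eq_frobenius:
  fixes X Y :: "real^'p^'q"
  shows "X \<bullet> Y = trace (transpose X ** Y)"
proof -
  have "X \<bullet> Y = (\<Sum>i\<in>UNIV. \<Sum>j\<in>UNIV. X $ i $ j * Y $ i $ j)"
    by (simp add: inner_vec_def)
  also have "\<dots> = (\<Sum>j\<in>UNIV. \<Sum>i\<in>UNIV. X $ i $ j * Y $ i $ j)"
    by (rule sum.swap)
  finally show ?thesis
    by (simp add: trace_def matrix_matrix_mult_def transpose_def)
qed

text \<open>The $k_1 k_2$ coordinates of the vectorisation of a $k_2 \times k_1$ matrix are indexed by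
  pairs (column, row); read in lexicographic order this stacks the columns.\<close>

definition vec_cols :: "real^'k1^'k2 \<Rightarrow> real^('k1 \<times> 'k2)" where
  "vec_cols A = (\<chi> ji. A $ snd ji $ fst ji)"

definition random_linear_map ::
    "'w measure \<Rightarrow> ('w \<Rightarrow> 'z::euclidean_space \<Rightarrow> real^'k) \<Rightarrow> bool" where
  "random_linear_map M \<Theta> \<longleftrightarrow>
     (\<forall>\<omega>\<in>space M. linear (\<Theta> \<omega>)) \<and> (\<forall>x. (\<lambda>\<omega>. \<Theta> \<omega> x) \<in> borel_measurable M)"

text \<open>The range restriction on \<open>d\<close> is part of the notion. The event whose probability is
  bounded is measurable, because for a fixed linear map the condition is closed in \<open>(x, y)\<close>.\<close>

definition oblivious_subspace_embedding ::
    "'w measure \<Rightarrow> ('w \<Rightarrow> 'z::euclidean_space \<Rightarrow> real^'k) \<Rightarrow> real \<Rightarrow> real \<Rightarrow> nat \<Rightarrow> bool" where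
  "oblivious_subspace_embedding M \<Theta> \<epsilon> \<delta> d \<longleftrightarrow>
     1 \<le> d \<and> d \<le> DIM('z) \<and> random_linear_map M \<Theta> \<and>
     (\<forall>Z\<^sub>d :: 'z set. subspace Z\<^sub>d \<and> dim Z\<^sub>d = d \<longrightarrow>
        measure M {\<omega> \<in> space M. \<forall>x\<in>Z\<^sub>d. \<forall>y\<in>Z\<^sub>d.
          \<bar>x \<bullet> y - \<Theta> \<omega> x \<bullet> \<Theta> \<omega> y\<bar> \<le> \<epsilon> * norm x * norm y} \<ge> 1 - \<delta>)"

text \<open>Mutual independence of three random variables with different codomain types, which
  the library constant \<open>indep_vars\<close> does not cover: as there, the generated sigma-algebras
  are required to be independent.\<close>

definition (in prob_space) indep_vars3 ::
    "'b measure \<Rightarrow> ('a \<Rightarrow> 'b) \<Rightarrow> 'c measure \<Rightarrow> ('a \<Rightarrow> 'c) \<Rightarrow> 'd measure \<Rightarrow> ('a \<Rightarrow> 'd) \<Rightarrow> bool" where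
  "indep_vars3 N1 X1 N2 X2 N3 X3 \<longleftrightarrow>
     random_variable N1 X1 \<and> random_variable N2 X2 \<and> random_variable N3 X3 \<and>
     indep_sets (\<lambda>i::nat. [sets (vimage_algebra (space M) X1 N1),
                           sets (vimage_algebra (space M) X2 N2),
                           sets (vimage_algebra (space M) X3 N3)] ! i) {0, 1, 2}"

datatype scalars = Real_Scalars | Complex_Scalars

fun eta :: "scalars \<Rightarrow> real" where
  "eta Real_Scalars = 1"
| "eta Complex_Scalars = 2"

end

theory Submission
  imports Defs
begin

text \<open>
  Left multiplication by \<open>\<Omega>\<close> must be shown to preserve inner products on a \<open>d\<close>-dimensional space \<open>W\<close> of
  matrices, whereas the hypothesis speaks only about \<open>d\<close>-dimensional spaces of vectors. The columns of the
  matrices in \<open>W\<close> may span far too large a space for a direct application, and no moments of \<open>\<Omega>\<close> are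
  available. Instead, let \<open>s\<close> be a vector of independent random signs. The vectors \<open>X s\<close> with \<open>X \<in> W\<close>
  form a space \<open>W s\<close> of dimension at most \<open>d\<close>, on which \<open>\<Omega>\<close> fails with probability at most \<open>\<delta>'\<close>.
  Conversely, suppose that \<open>\<Omega>\<close> fails on \<open>W\<close>. By polarisation, some \<open>X \<in> W\<close> has a squared Frobenius norm
  distorted by more than the factor \<open>\<epsilon>'\<close>. For a suitable sign \<open>c\<close> the quadratic form
  \<open>Q(s) = c (\<parallel>\<Omega> X s\<parallel>\<^sup>2 - \<parallel>X s\<parallel>\<^sup>2) - \<epsilon>' \<parallel>X s\<parallel>\<^sup>2\<close> then has positive trace, and \<open>Q(s) > 0\<close> says that \<open>\<Omega>\<close> fails on \<open>W s\<close>.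

  A quadratic form in random signs with positive trace is positive with probability at least \<open>1 / 240\<close>
  (\<open>positive_trace_sign_fraction\<close>). Its mean is the trace, and its centred part \<open>Z\<close> satisfies
  \<open>E Z\<^sup>4 \<le> 81 (E Z\<^sup>2)\<^sup>2\<close> by Bonami's hypercontractive inequality (\<open>fourth_moment_bound_chaos\<close>); a centred variable
  with such a fourth moment is non-negative with probability bounded below (\<open>sign_mean_nonneg_fraction\<close>).
  Counting pairs of failing \<open>\<Omega>\<close> and \<open>s\<close> in two ways gives failure probability at most
  \<open>240 \<delta>' \<le> \<delta> / 3\<close> for \<open>\<Omega>\<close> on \<open>W\<close> (\<open>matrix_embedding_failure_le\<close>).

  Given \<open>\<Omega>\<close>, the same bound applies to \<open>\<Sigma>\<close> on the transposes of the matrices in \<open>\<Omega> W\<close>. Given both, the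
  hypothesis on \<open>\<Gamma>\<close> applies to the space of the vectors \<open>vec (\<Omega> X \<Sigma>\<^sup>*)\<close>. By independence the random
  spaces may be treated as fixed (\<open>indep_failure_le\<close>), and outside an event of probability at most \<open>\<delta>\<close> all three
  stages succeed. Their distortions compose multiplicatively (\<open>almost_isometric_trans\<close>), and
  \<open>(1 + \<epsilon> / 5)\<^sup>2 (1 + \<epsilon> / 4) \<le> 1 + \<epsilon>\<close>.
\<close>

section \<open>Averages over sign patterns\<close>

text \<open>A sign pattern on \<open>I\<close> is encoded as the set of indices that carry the sign \<open>+1\<close>. The uniform
  distribution on sign patterns then becomes plain averaging over \<open>Pow I\<close>, which splits in two
  under \<open>insert\<close> and so supports induction on \<open>I\<close>.\<close>

definition sign_of :: "'i set \<Rightarrow> 'i \<Rightarrow> real" where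
  "sign_of T i = (if i \<in> T then 1 else - 1)"

definition sign_mean :: "'i set \<Rightarrow> ('i set \<Rightarrow> real) \<Rightarrow> real" where
  "sign_mean I f = (\<Sum>T\<in>Pow I. f T) / 2 ^ card I"

lemma sign_mean_empty [simp]: "sign_mean {} f = f {}"
  by (simp add: sign_mean_def)

lemma sign_mean_insert:
  assumes "finite I" "n \<notin> I"
  shows "sign_mean (insert n I) f = sign_mean I (\<lambda>T. (f T + f (insert n T)) / 2)"
proof -
  have inj: "inj_on (insert n) (Pow I)"
    using assms by (auto simp: inj_on_def)
  have disj: "Pow I \<inter> insert n ` Pow I = {}"
    using assms by auto
  have "(\<Sum>T\<in>Pow (insert n I). f T) = (\<Sum>T\<in>Pow I. f T + f (insert n T))"
    using assms disj by (simp add: Pow_insert sum.union_disjoint sum.reindex[OF inj] sum.distrib)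
  then show ?thesis
    using assms by (simp add: sign_mean_def sum_divide_distrib field_simps)
qed

lemma sign_mean_cong:
  assumes "\<And>T. T \<subseteq> I \<Longrightarrow> f T = g T"
  shows "sign_mean I f = sign_mean I g"
  using assms by (simp add: sign_mean_def)

lemma sign_mean_mono:
  assumes "\<And>T. T \<subseteq> I \<Longrightarrow> f T \<le> g T"
  shows "sign_mean I f \<le> sign_mean I g"
  using assms by (auto simp: sign_mean_def intro!: divide_right_mono sum_mono)

lemma sign_mean_add: "sign_mean I (\<lambda>T. f T + g T) = sign_mean I f + sign_mean I g"
  by (simp add: sign_mean_def sum.distrib add_divide_distrib)

lemma sign_mean_diff: "sign_mean I (\<lambda>T. f T - g T) = sign_mean I f - sign_mean I g"
  by (simp add: sign_mean_def sum_subtractf diff_divide_distrib)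

lemma sign_mean_cmult: "sign_mean I (\<lambda>T. c * f T) = c * sign_mean I f"
  by (simp add: sign_mean_def sum_distrib_left)

lemma sign_mean_const:
  assumes "finite I"
  shows "sign_mean I (\<lambda>T. c) = c"
  using assms by (simp add: sign_mean_def card_Pow)

lemma sign_mean_Cauchy_Schwarz:
  "(sign_mean I (\<lambda>T. f T * g T))\<^sup>2 \<le> sign_mean I (\<lambda>T. (f T)\<^sup>2) * sign_mean I (\<lambda>T. (g T)\<^sup>2)"
proof -
  have "(\<Sum>T\<in>Pow I. f T * g T)\<^sup>2 \<le> (\<Sum>T\<in>Pow I. (f T)\<^sup>2) * (\<Sum>T\<in>Pow I. (g T)\<^sup>2)"
    by (rule Cauchy_Schwarz_ineq_sum)
  then show ?thesis
    by (simp add: sign_mean_def power_divide divide_right_mono flip: power2_eq_square)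
qed

lemma sign_mean_nonneg: "(\<And>T. T \<subseteq> I \<Longrightarrow> 0 \<le> f T) \<Longrightarrow> 0 \<le> sign_mean I f"
  by (auto simp: sign_mean_def intro!: divide_nonneg_nonneg sum_nonneg)

section \<open>Fourth moments of quadratic forms in random signs\<close>

definition fourth_moment_bound :: "'i set \<Rightarrow> real \<Rightarrow> ('i set \<Rightarrow> real) \<Rightarrow> bool" where
  "fourth_moment_bound I C f \<longleftrightarrow> sign_mean I (\<lambda>T. f T ^ 4) \<le> C * (sign_mean I (\<lambda>T. (f T)\<^sup>2))\<^sup>2"

text \<open>The inductive step of Bonami's lemma. Write \<open>f = h + s g\<close>, where \<open>s\<close> is the sign of the new index.
  Odd powers of \<open>s\<close> average to zero, so the fourth moment is \<open>E h\<^sup>4 + 6 E (g\<^sup>2 h\<^sup>2) + E g\<^sup>4\<close>, and by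
  Cauchy-Schwarz the mixed term is at most \<open>6 \<sqrt>(C \<cdot> 9 C) (E g\<^sup>2) (E h\<^sup>2) = 18 C (E g\<^sup>2) (E h\<^sup>2)\<close>. This is exactly
  the cross term of \<open>9 C (E h\<^sup>2 + E g\<^sup>2)\<^sup>2\<close>. The factor \<open>9\<close> pays for the degree: \<open>g\<close> has one
  degree less than \<open>f\<close> in the signs.\<close>

lemma fourth_moment_bound_insert:
  assumes I: "finite I" "n \<notin> I" and C: "0 \<le> C"
    and g: "fourth_moment_bound I C g" and h: "fourth_moment_bound I (9 * C) h"
    and f: "\<And>T. T \<subseteq> I \<Longrightarrow> f T = h T - g T" "\<And>T. T \<subseteq> I \<Longrightarrow> f (insert n T) = h T + g T"
  shows "fourth_moment_bound (insert n I) (9 * C) f"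
proof -
  define G where "G = sign_mean I (\<lambda>T. (g T)\<^sup>2)"
  define H where "H = sign_mean I (\<lambda>T. (h T)\<^sup>2)"
  define X where "X = sign_mean I (\<lambda>T. (g T)\<^sup>2 * (h T)\<^sup>2)"
  have nonneg: "0 \<le> G" "0 \<le> H"
    by (auto simp: G_def H_def intro!: sign_mean_nonneg)
  have g4: "sign_mean I (\<lambda>T. g T ^ 4) \<le> C * G\<^sup>2" and h4: "sign_mean I (\<lambda>T. h T ^ 4) \<le> 9 * C * H\<^sup>2"
    using g h by (simp_all add: fourth_moment_bound_def G_def H_def)
  have second: "sign_mean (insert n I) (\<lambda>T. (f T)\<^sup>2) = H + G"
  proof -
    have "sign_mean (insert n I) (\<lambda>T. (f T)\<^sup>2) = sign_mean I (\<lambda>T. (h T)\<^sup>2 + (g T)\<^sup>2)"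
      unfolding sign_mean_insert[OF I]
      by (rule sign_mean_cong) (simp add: f power2_eq_square algebra_simps)
    then show ?thesis by (simp add: sign_mean_add G_def H_def)
  qed
  have fourth: "sign_mean (insert n I) (\<lambda>T. f T ^ 4)
      = sign_mean I (\<lambda>T. h T ^ 4) + 6 * X + sign_mean I (\<lambda>T. g T ^ 4)"
  proof -
    have "sign_mean (insert n I) (\<lambda>T. f T ^ 4)
        = sign_mean I (\<lambda>T. h T ^ 4 + 6 * ((g T)\<^sup>2 * (h T)\<^sup>2) + g T ^ 4)"
      unfolding sign_mean_insert[OF I]
      by (rule sign_mean_cong) (simp add: f power2_eq_square power4_eq_xxxx field_simps)
    then show ?thesis by (simp add: sign_mean_add sign_mean_cmult X_def)
  qed
  have "X\<^sup>2 \<le> sign_mean I (\<lambda>T. g T ^ 4) * sign_mean I (\<lambda>T. h T ^ 4)"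
    using sign_mean_Cauchy_Schwarz[of I "\<lambda>T. (g T)\<^sup>2" "\<lambda>T. (h T)\<^sup>2"] by (simp add: X_def)
  also have "\<dots> \<le> (C * G\<^sup>2) * (9 * C * H\<^sup>2)"
    using C g4 h4 by (intro mult_mono) (auto intro!: sign_mean_nonneg)
  also have "\<dots> = (3 * C * G * H)\<^sup>2"
    by (simp add: power2_eq_square)
  finally have "X \<le> 3 * C * G * H"
    using C nonneg by (meson mult_nonneg_nonneg power2_le_imp_le zero_le_numeral)
  then have "sign_mean (insert n I) (\<lambda>T. f T ^ 4) \<le> 9 * C * H\<^sup>2 + 18 * C * G * H + C * G\<^sup>2"
    using g4 h4 by (simp add: fourth)
  also have "\<dots> \<le> 9 * C * (H + G)\<^sup>2"
    using C nonneg by (simp add: power2_eq_square algebra_simps)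
  finally show ?thesis
    by (simp add: fourth_moment_bound_def second)
qed

lemma fourth_moment_bound_affine:
  assumes "finite I"
  shows "fourth_moment_bound I 9 (\<lambda>T. c + (\<Sum>i\<in>I. b i * sign_of T i))"
  using assms
proof (induction I)
  case empty
  have "c ^ 4 = (c\<^sup>2)\<^sup>2" by simp
  moreover have "0 \<le> (c\<^sup>2)\<^sup>2" by simp
  ultimately show ?case by (simp add: fourth_moment_bound_def)
next
  case (insert n I)
  have const: "fourth_moment_bound I 1 (\<lambda>T. b n)"
    using insert by (simp add: fourth_moment_bound_def sign_mean_const)
  have "fourth_moment_bound (insert n I) (9 * 1) (\<lambda>T. c + (\<Sum>i\<in>insert n I. b i * sign_of T i))"
  proof (rule fourth_moment_bound_insert[where g = "\<lambda>T. b n"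
        and h = "\<lambda>T. c + (\<Sum>i\<in>I. b i * sign_of T i)"])
    fix T assume "T \<subseteq> I"
    then have "sign_of T n = - 1" "sign_of (insert n T) n = 1"
      and "\<And>i. i \<in> I \<Longrightarrow> sign_of (insert n T) i = sign_of T i"
      using insert by (auto simp: sign_of_def)
    then show "c + (\<Sum>i\<in>insert n I. b i * sign_of T i) = c + (\<Sum>i\<in>I. b i * sign_of T i) - b n"
      and "c + (\<Sum>i\<in>insert n I. b i * sign_of (insert n T) i) = c + (\<Sum>i\<in>I. b i * sign_of T i) + b n"
      using insert by simp_all
  qed (use insert const in auto)
  then show ?case by simp
qed

text \<open>The diagonal of \<open>B\<close> is kept in the sum although the squares of signs are constant: the recursion on
  the index set then moves \<open>B n n\<close> into the constant \<open>c\<close>, and matrices can be inserted as they are.\<close>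

definition chaos :: "'i set \<Rightarrow> real \<Rightarrow> ('i \<Rightarrow> 'i \<Rightarrow> real) \<Rightarrow> 'i set \<Rightarrow> real" where
  "chaos I c B T = c + (\<Sum>i\<in>I. \<Sum>j\<in>I. B i j * sign_of T i * sign_of T j)"

lemma chaos_insert:
  fixes B :: "'i \<Rightarrow> 'i \<Rightarrow> real"
  assumes "finite I" "n \<notin> I" "T \<subseteq> I"
  defines "g \<equiv> (\<Sum>i\<in>I. (B i n + B n i) * sign_of T i)"
  shows "chaos (insert n I) c B T = chaos I (c + B n n) B T - g"
    and "chaos (insert n I) c B (insert n T) = chaos I (c + B n n) B T + g"
proof -
  have n: "sign_of T n = - 1" "sign_of (insert n T) n = 1"
    and s: "\<And>i. i \<in> I \<Longrightarrow> sign_of (insert n T) i = sign_of T i"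
    using assms by (auto simp: sign_of_def)
  show "chaos (insert n I) c B T = chaos I (c + B n n) B T - g"
    using assms by (simp add: chaos_def g_def n sum.distrib sum_subtractf sum_negf algebra_simps)
  show "chaos (insert n I) c B (insert n T) = chaos I (c + B n n) B T + g"
    using assms by (simp add: chaos_def g_def n s sum.distrib algebra_simps)
qed

lemma fourth_moment_bound_chaos:
  assumes "finite I"
  shows "fourth_moment_bound I 81 (chaos I c B)"
  using assms
proof (induction I arbitrary: c)
  case empty
  have "c ^ 4 = (c\<^sup>2)\<^sup>2" by simp
  moreover have "0 \<le> (c\<^sup>2)\<^sup>2" by simp
  ultimately show ?case by (simp add: fourth_moment_bound_def chaos_def)
next
  case (insert n I)
  have "fourth_moment_bound (insert n I) (9 * 9) (chaos (insert n I) c B)"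
    using insert fourth_moment_bound_affine[of I 0 "\<lambda>i. B i n + B n i"]
    by (intro fourth_moment_bound_insert[where h = "chaos I (c + B n n) B"
          and g = "\<lambda>T. \<Sum>i\<in>I. (B i n + B n i) * sign_of T i"])
      (simp_all add: chaos_insert)
  then show ?case by simp
qed

lemma sign_mean_chaos:
  assumes "finite I"
  shows "sign_mean I (chaos I c B) = c + (\<Sum>i\<in>I. B i i)"
  using assms
proof (induction I arbitrary: c)
  case empty
  then show ?case by (simp add: chaos_def)
next
  case (insert n I)
  have "sign_mean (insert n I) (chaos (insert n I) c B) = sign_mean I (chaos I (c + B n n) B)"
    unfolding sign_mean_insert[OF insert(1,2)]
    by (rule sign_mean_cong) (simp add: chaos_insert[OF insert(1,2)])
  then show ?case using insert by simp
qed

text \<open>A quartic below a multiple of the step function. It is made for a centred variable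
  with unit variance and fourth moment at most \<open>81\<close>: in the mean the linear term vanishes and what
  remains is at least \<open>1 - 81 / 162 = 1 / 2\<close>. The coefficient \<open>7\<close> of the linear term pushes the quartic
  below zero on the negative half-line; its price is the bound \<open>120\<close> on the positive one.\<close>

lemma step_minorant:
  fixes u :: real
  shows "7 * u + u\<^sup>2 - u ^ 4 / 162 \<le> (if 0 \<le> u then 120 else 0)"
proof (cases "0 \<le> u")
  case True
  \<comment> \<open>Completing squares, first in \<open>u\<^sup>2\<close> near the maximum of the quartic at about \<open>u = 10\<close>, then in \<open>u\<close>.\<close>
  have "162 * (120 - (7 * u + u\<^sup>2 - u ^ 4 / 162))
      = (u\<^sup>2 - 100)\<^sup>2 + 38 * (u - 567 / 38)\<^sup>2 + 37231 / 38"
    by (simp add: power2_eq_square power4_eq_xxxx algebra_simps)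
  also have "\<dots> \<ge> 0" by simp
  finally show ?thesis using True by simp
next
  case False
  \<comment> \<open>The bracket equals \<open>1134 + 162 u - u\<^sup>3\<close>; its first summand is a cubic with the same leading
    term and a double root near the minimum.\<close>
  have "- 162 * (7 * u + u\<^sup>2 - u ^ 4 / 162) = - u * ((u + 8)\<^sup>2 * (16 - u) + 30 * (- u) + 110)"
    by (simp add: power2_eq_square power4_eq_xxxx algebra_simps)
  also have "\<dots> \<ge> 0"
    using False by (intro mult_nonneg_nonneg add_nonneg_nonneg) auto
  finally show ?thesis using False by simp
qed

text \<open>A centred variable with controlled kurtosis cannot be negative almost always: a small probability of
  being non-negative would force rare large positive values, hence a large fourth moment.\<close>

lemma sign_mean_nonneg_fraction:
  assumes I: "finite I" and f0: "sign_mean I f = 0" and f4: "fourth_moment_bound I 81 f"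
  shows "1 / 240 \<le> sign_mean I (\<lambda>T. if 0 \<le> f T then 1 else 0)"
proof -
  define v where "v = sign_mean I (\<lambda>T. (f T)\<^sup>2)"
  have "0 \<le> v" by (auto simp: v_def intro!: sign_mean_nonneg)
  show ?thesis
  proof (cases "v = 0")
    case True
    then have "(\<Sum>T\<in>Pow I. (f T)\<^sup>2) = 0"
      by (simp add: v_def sign_mean_def)
    then have "f T = 0" if "T \<subseteq> I" for T
      using I that by (subst (asm) sum_nonneg_eq_0_iff) auto
    then have "sign_mean I (\<lambda>T. if 0 \<le> f T then 1 else 0) = sign_mean I (\<lambda>T. 1)"
      by (intro sign_mean_cong) simp
    then show ?thesis using I by (simp add: sign_mean_const)
  next
    case False
    define s where "s = sqrt v"
    have s: "0 < s" "s\<^sup>2 = v" "s ^ 4 = v\<^sup>2"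
      using False \<open>0 \<le> v\<close> by (auto simp: s_def real_sqrt_pow2_iff power4_eq_xxxx power2_eq_square)
    \<comment> \<open>Average the quartic minorant at \<open>f / s\<close>, the variable normalised to unit variance.\<close>
    have "1 / 2 \<le> (7 / s) * sign_mean I f + (1 / s\<^sup>2) * v
        - (1 / (162 * s ^ 4)) * sign_mean I (\<lambda>T. f T ^ 4)"
      using f4 False \<open>0 \<le> v\<close> by (simp add: f0 s fourth_moment_bound_def field_simps flip: v_def)
    also have "\<dots> = sign_mean I (\<lambda>T. (7 / s) * f T + (1 / s\<^sup>2) * (f T)\<^sup>2 - (1 / (162 * s ^ 4)) * f T ^ 4)"
      unfolding v_def by (simp only: sign_mean_add sign_mean_diff sign_mean_cmult)
    also have "\<dots> \<le> sign_mean I (\<lambda>T. 120 * (if 0 \<le> f T then 1 else 0))"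
    proof (rule sign_mean_mono)
      fix T
      have "7 * (f T / s) + (f T / s)\<^sup>2 - (f T / s) ^ 4 / 162 \<le> (if 0 \<le> f T / s then 120 else 0)"
        by (rule step_minorant)
      then show "(7 / s) * f T + (1 / s\<^sup>2) * (f T)\<^sup>2 - (1 / (162 * s ^ 4)) * f T ^ 4
          \<le> 120 * (if 0 \<le> f T then 1 else 0)"
        using s(1) by (simp add: power_divide zero_le_divide_iff mult.commute split: if_splits)
    qed
    also have "\<dots> = 120 * sign_mean I (\<lambda>T. if 0 \<le> f T then 1 else 0)"
      by (rule sign_mean_cmult)
    finally show ?thesis by simp
  qed
qed

text \<open>The mean of the quadratic form is its trace. Subtracting it leaves a centred form, which is
  non-negative for a fraction \<open>1 / 240\<close> of the signs; there the form itself is at least its trace. The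
  fraction depends neither on the number of signs nor on how small the trace is compared with \<open>B\<close>.\<close>

lemma positive_trace_sign_fraction:
  fixes B :: "'n::finite \<Rightarrow> 'n \<Rightarrow> real"
  assumes "0 < (\<Sum>i\<in>UNIV. B i i)"
  shows "2 ^ CARD('n) \<le> 240 * real (card {T. 0 < (\<Sum>i\<in>UNIV. \<Sum>j\<in>UNIV. B i j * sign_of T i * sign_of T j)})"
proof -
  let ?c = "- (\<Sum>i\<in>UNIV. B i i)"
  let ?P = "{T. 0 < (\<Sum>i\<in>UNIV. \<Sum>j\<in>UNIV. B i j * sign_of T i * sign_of T j)}"
  have "1 / 240 \<le> sign_mean UNIV (\<lambda>T. if 0 \<le> chaos UNIV ?c B T then 1 else 0)"
    by (rule sign_mean_nonneg_fraction)
      (auto simp: sign_mean_chaos intro: fourth_moment_bound_chaos)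
  also have "\<dots> \<le> sign_mean UNIV (\<lambda>T. if T \<in> ?P then 1 else 0)"
    using assms by (intro sign_mean_mono) (auto simp: chaos_def)
  also have "\<dots> = real (card ?P) / 2 ^ CARD('n)"
    by (simp add: sign_mean_def sum.If_cases)
  finally show ?thesis by (simp add: field_simps)
qed

section \<open>Linear maps between matrix spaces\<close>

lemma continuous_on_matrix_matrix_mult [continuous_intros]:
  fixes f :: "'a::topological_space \<Rightarrow> real^'m^'n" and g :: "'a \<Rightarrow> real^'l^'m"
  assumes "continuous_on S f" "continuous_on S g"
  shows "continuous_on S (\<lambda>x. f x ** g x)"
  unfolding matrix_matrix_mult_def by (intro continuous_intros assms)

lemma continuous_on_matrix_vector_mult [continuous_intros]:
  fixes f :: "'a::topological_space \<Rightarrow> real^'m^'n" and g :: "'a \<Rightarrow> real^'m"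
  assumes "continuous_on S f" "continuous_on S g"
  shows "continuous_on S (\<lambda>x. f x *v g x)"
  unfolding matrix_vector_mult_def by (intro continuous_intros assms)

lemma continuous_on_transpose [continuous_intros]:
  fixes f :: "'a::topological_space \<Rightarrow> real^'m^'n"
  assumes "continuous_on S f"
  shows "continuous_on S (\<lambda>x. transpose (f x))"
  unfolding transpose_def by (intro continuous_intros assms)

lemma continuous_on_vec_cols [continuous_intros]:
  fixes f :: "'a::topological_space \<Rightarrow> real^'m^'n"
  assumes "continuous_on S f"
  shows "continuous_on S (\<lambda>x. vec_cols (f x))"
  unfolding vec_cols_def by (intro continuous_intros assms)

lemma linear_matrix_mult_right: "linear (\<lambda>X :: real^'m^'n. A ** X)"
  by (rule linearI)
    (simp_all add: matrix_add_ldistrib matrix_scaleR matrix_matrix_mult_def vec_eq_iff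
      sum_distrib_left sum.distrib algebra_simps)

lemma linear_matrix_mult_left: "linear (\<lambda>X :: real^'m^'n. X ** A)"
  by (rule linearI)
    (simp_all add: matrix_matrix_mult_def vec_eq_iff sum_distrib_left sum.distrib algebra_simps)

lemma linear_matrix_vector_mult_left: "linear (\<lambda>X :: real^'m^'n. X *v s)"
  by (rule linearI)
    (simp_all add: matrix_vector_mult_def vec_eq_iff sum_distrib_left sum.distrib algebra_simps)

lemma linear_transpose: "linear (transpose :: real^'m^'n \<Rightarrow> real^'n^'m)"
  by (rule linearI) (simp_all add: transpose_def vec_eq_iff)

lemma linear_vec_cols: "linear (vec_cols :: real^'m^'n \<Rightarrow> _)"
  by (rule linearI) (simp_all add: vec_cols_def vec_eq_iff)

text \<open>Transposing and stacking columns are isometries for the Frobenius inner product. Hence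
  right multiplication by a transpose is left multiplication in disguise, and distortion of a
  vectorised matrix is distortion of the matrix.\<close>

lemma inner_transpose:
  fixes X Y :: "real^'m^'n"
  shows "transpose X \<bullet> transpose Y = X \<bullet> Y"
  by (simp add: inner_vec_def transpose_def) (rule sum.swap)

lemma norm_transpose:
  fixes X :: "real^'m^'n"
  shows "norm (transpose X) = norm X"
  by (simp add: norm_eq_sqrt_inner inner_transpose)

lemma inner_vec_cols:
  fixes X Y :: "real^'m^'n"
  shows "vec_cols X \<bullet> vec_cols Y = X \<bullet> Y"
proof -
  have "vec_cols X \<bullet> vec_cols Y = (\<Sum>j\<in>UNIV. \<Sum>i\<in>UNIV. X $ i $ j * Y $ i $ j)"
    by (simp add: inner_vec_def vec_cols_def sum.cartesian_product case_prod_unfold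
        flip: UNIV_Times_UNIV)
  then show ?thesis
    by (subst (asm) sum.swap) (simp add: inner_vec_def)
qed

lemma norm_vec_cols:
  fixes X :: "real^'m^'n"
  shows "norm (vec_cols X) = norm X"
  by (simp add: norm_eq_sqrt_inner inner_vec_cols)

section \<open>Distortion of inner products\<close>

text \<open>Distortion is measured relative to a reference map \<open>g\<close> instead of the inner product of the domain,
  so that the three stages of a composition can all be compared on one subspace \<open>W\<close> of the
  original space, and so that distortion on an image subspace pulls back.\<close>

definition almost_isometric ::
    "real \<Rightarrow> 'a set \<Rightarrow> ('a \<Rightarrow> 'b::real_inner) \<Rightarrow> ('a \<Rightarrow> 'c::real_inner) \<Rightarrow> bool" where
  "almost_isometric \<epsilon> W g f \<longleftrightarrow>
     (\<forall>x\<in>W. \<forall>y\<in>W. \<bar>g x \<bullet> g y - f x \<bullet> f y\<bar> \<le> \<epsilon> * norm (g x) * norm (g y))"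

lemma almost_isometric_image:
  "almost_isometric \<epsilon> (h ` W) g f \<longleftrightarrow> almost_isometric \<epsilon> W (\<lambda>x. g (h x)) (\<lambda>x. f (h x))"
  by (simp add: almost_isometric_def)

lemma almost_isometric_mono:
  "almost_isometric \<epsilon> W g f \<Longrightarrow> V \<subseteq> W \<Longrightarrow> almost_isometric \<epsilon> V g f"
  by (auto simp: almost_isometric_def)

lemma almost_isometric_weaken:
  assumes "almost_isometric a W g f" "a \<le> b"
  shows "almost_isometric b W g f"
  unfolding almost_isometric_def
proof (intro ballI)
  fix x y assume "x \<in> W" "y \<in> W"
  then have "\<bar>g x \<bullet> g y - f x \<bullet> f y\<bar> \<le> a * (norm (g x) * norm (g y))"
    using assms(1) by (simp add: almost_isometric_def mult.assoc)
  also have "\<dots> \<le> b * (norm (g x) * norm (g y))"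
    using assms(2) by (intro mult_right_mono) auto
  finally show "\<bar>g x \<bullet> g y - f x \<bullet> f y\<bar> \<le> b * norm (g x) * norm (g y)"
    by (simp add: mult.assoc)
qed

lemma almost_isometric_norm_le:
  assumes "almost_isometric a W g f" "x \<in> W"
  shows "(norm (f x))\<^sup>2 \<le> (1 + a) * (norm (g x))\<^sup>2"
proof -
  have "\<bar>g x \<bullet> g x - f x \<bullet> f x\<bar> \<le> a * norm (g x) * norm (g x)"
    using assms by (simp add: almost_isometric_def)
  also have "\<dots> = a * (norm (g x))\<^sup>2"
    by (simp add: power2_eq_square)
  finally have "\<bar>(norm (g x))\<^sup>2 - (norm (f x))\<^sup>2\<bar> \<le> a * (norm (g x))\<^sup>2"
    by (simp only: power2_norm_eq_inner)
  then have "(norm (f x))\<^sup>2 \<le> (norm (g x))\<^sup>2 + a * (norm (g x))\<^sup>2"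
    by linarith
  then show ?thesis by (simp add: distrib_right)
qed

lemma almost_isometric_trans:
  assumes gf: "almost_isometric a W g f" and fh: "almost_isometric b W f h"
    and ab: "0 \<le> a" "0 \<le> b"
  shows "almost_isometric ((1 + a) * (1 + b) - 1) W g h"
  unfolding almost_isometric_def
proof (intro ballI)
  fix x y assume xy: "x \<in> W" "y \<in> W"
  have "(norm (f x) * norm (f y))\<^sup>2 \<le> ((1 + a) * (norm (g x))\<^sup>2) * ((1 + a) * (norm (g y))\<^sup>2)"
    using ab almost_isometric_norm_le[OF gf] xy unfolding power_mult_distrib
    by (intro mult_mono) auto
  also have "\<dots> = ((1 + a) * (norm (g x) * norm (g y)))\<^sup>2"
    by (simp add: power2_eq_square)
  finally have norms: "norm (f x) * norm (f y) \<le> (1 + a) * (norm (g x) * norm (g y))"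
    by (rule power2_le_imp_le) (use ab in simp)
  have "\<bar>g x \<bullet> g y - h x \<bullet> h y\<bar> \<le> \<bar>g x \<bullet> g y - f x \<bullet> f y\<bar> + \<bar>f x \<bullet> f y - h x \<bullet> h y\<bar>"
    by simp
  also have "\<dots> \<le> a * norm (g x) * norm (g y) + b * norm (f x) * norm (f y)"
    using gf fh xy by (intro add_mono) (auto simp: almost_isometric_def)
  also have "\<dots> \<le> a * norm (g x) * norm (g y) + b * ((1 + a) * (norm (g x) * norm (g y)))"
    using mult_left_mono[OF norms ab(2)] by (simp add: mult.assoc)
  also have "\<dots> = ((1 + a) * (1 + b) - 1) * norm (g x) * norm (g y)"
    by (simp add: algebra_simps)
  finally show "\<bar>g x \<bullet> g y - h x \<bullet> h y\<bar> \<le> ((1 + a) * (1 + b) - 1) * norm (g x) * norm (g y)" .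
qed

text \<open>Closedness of the set of well-behaved parameters is what makes the events in question measurable,
  although they quantify over uncountably many vectors.\<close>

lemma closed_almost_isometric:
  fixes f :: "'p::topological_space \<Rightarrow> 'a \<Rightarrow> 'b::real_inner"
    and g :: "'p \<Rightarrow> 'a \<Rightarrow> 'c::real_inner"
  assumes [continuous_intros]: "\<And>x. continuous_on UNIV (\<lambda>p. f p x)" "\<And>x. continuous_on UNIV (\<lambda>p. g p x)"
  shows "closed {p. almost_isometric \<epsilon> W (g p) (f p)}"
proof -
  have "{p. almost_isometric \<epsilon> W (g p) (f p)} = (\<Inter>x\<in>W. \<Inter>y\<in>W.
      {p. \<bar>g p x \<bullet> g p y - f p x \<bullet> f p y\<bar> \<le> \<epsilon> * norm (g p x) * norm (g p y)})"
    by (auto simp: almost_isometric_def)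
  also have "closed \<dots>"
    by (intro closed_INT ballI closed_Collect_le continuous_intros)
  finally show ?thesis .
qed

text \<open>By polarisation, distorting the squared norms of \<open>u + v\<close> and \<open>u - v\<close> by a factor \<open>\<epsilon>\<close> distorts the inner
  product of unit vectors by at most \<open>\<epsilon> (\<parallel>u + v\<parallel>\<^sup>2 + \<parallel>u - v\<parallel>\<^sup>2) / 4 = \<epsilon>\<close>. So a single bad
  vector witnesses the failure of the bound on a whole subspace.\<close>

lemma almost_isometric_from_norms:
  fixes f :: "'a::real_inner \<Rightarrow> 'b::real_inner"
  assumes f: "linear f" and W: "subspace W"
    and norms: "\<And>x. x \<in> W \<Longrightarrow> \<bar>(norm x)\<^sup>2 - (norm (f x))\<^sup>2\<bar> \<le> \<epsilon> * (norm x)\<^sup>2"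
  shows "almost_isometric \<epsilon> W (\<lambda>x. x) f"
  unfolding almost_isometric_def
proof (intro ballI)
  fix x y assume xy: "x \<in> W" "y \<in> W"
  define B where "B u v = u \<bullet> v - f u \<bullet> f v" for u v
  interpret f: linear f by (rule f)
  show "\<bar>x \<bullet> y - f x \<bullet> f y\<bar> \<le> \<epsilon> * norm x * norm y"
  proof (cases "x = 0 \<or> y = 0")
    case True
    then show ?thesis by (auto simp: f.zero)
  next
    case False
    define u v where "u = x /\<^sub>R norm x" and "v = y /\<^sub>R norm y"
    have x: "x = norm x *\<^sub>R u" and y: "y = norm y *\<^sub>R v"
      using False by (simp_all add: u_def v_def)
    have uv: "u \<in> W" "v \<in> W" "u \<bullet> u = 1" "v \<bullet> v = 1"
      using W xy False by (auto simp: u_def v_def subspace_scale dot_square_norm power2_eq_square)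
    have diag: "\<bar>B z z\<bar> \<le> \<epsilon> * (z \<bullet> z)" if "z \<in> W" for z
      using norms[OF that] by (simp add: B_def power2_norm_eq_inner)
    have "4 * B u v = B (u + v) (u + v) - B (u - v) (u - v)"
      by (simp add: B_def f.add f.diff inner_simps inner_commute algebra_simps)
    then have "4 * \<bar>B u v\<bar> \<le> \<bar>B (u + v) (u + v)\<bar> + \<bar>B (u - v) (u - v)\<bar>"
      by linarith
    also have "\<dots> \<le> \<epsilon> * ((u + v) \<bullet> (u + v)) + \<epsilon> * ((u - v) \<bullet> (u - v))"
      using W uv by (intro add_mono diag) (auto simp: subspace_add subspace_diff)
    also have "\<dots> = \<epsilon> * (2 * (u \<bullet> u) + 2 * (v \<bullet> v))"
      by (simp add: inner_simps inner_commute algebra_simps)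
    also have "\<dots> = 4 * \<epsilon>"
      using uv by simp
    finally have "\<bar>B u v\<bar> \<le> \<epsilon>" by simp
    then have "norm x * norm y * \<bar>B u v\<bar> \<le> norm x * norm y * \<epsilon>"
      by (intro mult_left_mono) auto
    moreover have "B x y = norm x * norm y * B u v"
      by (subst x, subst y) (simp add: B_def f.scale algebra_simps)
    ultimately have "\<bar>B x y\<bar> \<le> \<epsilon> * norm x * norm y"
      by (simp add: abs_mult mult.commute mult.left_commute)
    then show ?thesis by (simp add: B_def)
  qed
qed

lemma almost_isometric_diag:
  assumes "almost_isometric \<epsilon> W (\<lambda>x. x) f" "x \<in> W"
  shows "\<bar>(norm x)\<^sup>2 - (norm (f x))\<^sup>2\<bar> \<le> \<epsilon> * (norm x)\<^sup>2"
proof -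
  have "\<bar>x \<bullet> x - f x \<bullet> f x\<bar> \<le> \<epsilon> * norm x * norm x"
    using assms by (simp add: almost_isometric_def)
  also have "\<dots> = \<epsilon> * (norm x)\<^sup>2"
    by (simp add: power2_eq_square)
  finally show ?thesis
    by (simp only: power2_norm_eq_inner)
qed

section \<open>Detecting distorted matrices by sign vectors\<close>

definition sign_vector :: "'n set \<Rightarrow> real^'n" where
  "sign_vector T = (\<chi> i. sign_of T i)"

lemma norm_matrix_sign_vector:
  fixes A :: "real^'n^'m"
  shows "(norm (A *v sign_vector T))\<^sup>2
    = (\<Sum>i\<in>UNIV. \<Sum>j\<in>UNIV. (column i A \<bullet> column j A) * sign_of T i * sign_of T j)"
proof -
  have "A *v sign_vector T = (\<Sum>i\<in>UNIV. sign_of T i *\<^sub>R column i A)"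
    by (simp add: matrix_mult_sum sign_vector_def scalar_mult_eq_scaleR)
  then show ?thesis
    by (simp add: power2_norm_eq_inner inner_sum_left inner_sum_right sum_distrib_left
        inner_commute mult_ac)
qed

lemma norm_eq_sum_columns:
  fixes A :: "real^'n^'m"
  shows "(norm A)\<^sup>2 = (\<Sum>i\<in>UNIV. column i A \<bullet> column i A)"
  by (simp add: power2_norm_eq_inner inner_vec_def column_def) (rule sum.swap)

text \<open>Both squared norms on the right are quadratic forms in the signs whose traces are the squared
  Frobenius norms.\<close>

lemma positive_sign_fraction:
  fixes A :: "real^'n^'m" and X :: "real^'n^'q"
  assumes "0 < a * (norm A)\<^sup>2 + b * (norm X)\<^sup>2"
  shows "2 ^ CARD('n) \<le> 240 * real (card
    {T. 0 < a * (norm (A *v sign_vector T))\<^sup>2 + b * (norm (X *v sign_vector T))\<^sup>2})"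
proof -
  define B where "B i j = a * (column i A \<bullet> column j A) + b * (column i X \<bullet> column j X)" for i j
  have "a * (norm A)\<^sup>2 + b * (norm X)\<^sup>2 = (\<Sum>i\<in>UNIV. B i i)"
    by (simp add: B_def norm_eq_sum_columns sum.distrib sum_distrib_left)
  moreover have "a * (norm (A *v sign_vector T))\<^sup>2 + b * (norm (X *v sign_vector T))\<^sup>2
      = (\<Sum>i\<in>UNIV. \<Sum>j\<in>UNIV. B i j * sign_of T i * sign_of T j)" for T
    by (simp add: B_def norm_matrix_sign_vector sum.distrib sum_distrib_left sum.distrib algebra_simps)
  ultimately show ?thesis
    using assms positive_trace_sign_fraction[of B] by simp
qed

text \<open>Passing from matrices to vectors costs only a constant factor: if left multiplication by \<open>A\<close> distorts
  the squared norm of some matrix \<open>X \<in> W\<close> by more than the factor \<open>\<epsilon>\<close>, then so does \<open>A\<close> with the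
  vector \<open>X s\<close> for a fixed fraction of the sign vectors \<open>s\<close>. The choice of \<open>X\<close> depends on \<open>A\<close>, but the subspaces \<open>W s\<close> on the
  right do not.\<close>

lemma distorted_sign_fraction:
  fixes A :: "real^'q^'k" and W :: "(real^'n^'q) set"
  assumes W: "subspace W" and bad: "\<not> almost_isometric \<epsilon> W (\<lambda>X. X) (\<lambda>X. A ** X)"
  shows "2 ^ CARD('n) \<le> 240 * real (card
    {T. \<not> almost_isometric \<epsilon> ((\<lambda>X. X *v sign_vector T) ` W) (\<lambda>x. x) (\<lambda>x. A *v x)})"
    (is "_ \<le> 240 * real (card ?bad)")
proof -
  from bad almost_isometric_from_norms[OF linear_matrix_mult_right W, of A \<epsilon>]
  obtain X where X: "X \<in> W" "\<epsilon> * (norm X)\<^sup>2 < \<bar>(norm X)\<^sup>2 - (norm (A ** X))\<^sup>2\<bar>"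
    by (meson not_le)
  \<comment> \<open>The sign \<open>c\<close> records whether the norm of \<open>X\<close> is increased or decreased; either way the
    excess distortion is a quadratic form with positive trace.\<close>
  define c :: real where "c = (if (norm X)\<^sup>2 \<le> (norm (A ** X))\<^sup>2 then 1 else - 1)"
  let ?P = "{T. 0 < c * (norm ((A ** X) *v sign_vector T))\<^sup>2
      + (- c - \<epsilon>) * (norm (X *v sign_vector T))\<^sup>2}"
  have "0 < c * (norm (A ** X))\<^sup>2 + (- c - \<epsilon>) * (norm X)\<^sup>2"
    using X(2) by (auto simp: c_def algebra_simps split: if_splits)
  then have "2 ^ CARD('n) \<le> 240 * real (card ?P)"
    by (rule positive_sign_fraction)
  also have "\<dots> \<le> 240 * real (card ?bad)"
  proof -
    have "?P \<subseteq> ?bad"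
    proof
      fix T assume "T \<in> ?P"
      then have *: "\<epsilon> * (norm (X *v sign_vector T))\<^sup>2
          < \<bar>(norm (X *v sign_vector T))\<^sup>2 - (norm (A *v (X *v sign_vector T)))\<^sup>2\<bar>"
        by (auto simp: c_def matrix_vector_mul_assoc algebra_simps split: if_splits)
      show "T \<in> ?bad"
      proof
        show "\<not> almost_isometric \<epsilon> ((\<lambda>X. X *v sign_vector T) ` W) (\<lambda>x. x) (\<lambda>x. A *v x)"
          using almost_isometric_diag[of \<epsilon> "(\<lambda>X. X *v sign_vector T) ` W" "\<lambda>x. A *v x"
              "X *v sign_vector T"] * X(1) by force
      qed
    qed
    then have "card ?P \<le> card ?bad" by (intro card_mono) auto
    then show ?thesis by simp
  qed
  finally show ?thesis .
qed

lemma subspace_superset_of_dim: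
  fixes V :: "'a::euclidean_space set"
  assumes "subspace V" "dim V \<le> d" "d \<le> DIM('a)"
  shows "\<exists>Z. subspace Z \<and> dim Z = d \<and> V \<subseteq> Z"
  using assms(2,3)
proof (induction d rule: dec_induct)
  case base
  then show ?case using assms(1) by blast
next
  case (step n)
  then obtain Z where Z: "subspace Z" "dim Z = n" "V \<subseteq> Z" by auto
  then have "Z \<noteq> UNIV" using step by auto
  then obtain x where "x \<notin> Z" by auto
  then have "dim (span (insert x Z)) = Suc n"
    using Z by (simp add: dim_insert span_eq_iff[THEN iffD2])
  then show ?case
    using Z by (intro exI[of _ "span (insert x Z)"]) (auto intro: span_base)
qed

section \<open>Failure probabilities\<close>

lemma (in prob_space) prob_ge_iff_complement_le:
  assumes "{\<omega> \<in> space M. P \<omega>} \<in> events"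
  shows "1 - \<delta> \<le> prob {\<omega> \<in> space M. P \<omega>} \<longleftrightarrow> prob {\<omega> \<in> space M. \<not> P \<omega>} \<le> \<delta>"
  using prob_neg[OF assms] by auto

lemma almost_isometric_measurable:
  fixes f :: "'p::second_countable_topology \<Rightarrow> 'a \<Rightarrow> 'b::real_inner"
    and g :: "'p \<Rightarrow> 'a \<Rightarrow> 'c::real_inner"
  assumes "\<And>x. continuous_on UNIV (\<lambda>p. f p x)" "\<And>x. continuous_on UNIV (\<lambda>p. g p x)"
    and X: "X \<in> borel_measurable M"
  shows "{\<omega> \<in> space M. almost_isometric \<epsilon> W (g (X \<omega>)) (f (X \<omega>))} \<in> sets M"
    and "{\<omega> \<in> space M. \<not> almost_isometric \<epsilon> W (g (X \<omega>)) (f (X \<omega>))} \<in> sets M"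
proof -
  have "{p. almost_isometric \<epsilon> W (g p) (f p)} \<in> sets borel"
    using assms by (intro borel_closed closed_almost_isometric)
  then have "X -` {p. almost_isometric \<epsilon> W (g p) (f p)} \<inter> space M \<in> sets M"
    using X by (rule measurable_sets[rotated])
  then show *: "{\<omega> \<in> space M. almost_isometric \<epsilon> W (g (X \<omega>)) (f (X \<omega>))} \<in> sets M"
    by (simp add: vimage_def Int_def conj_commute)
  show "{\<omega> \<in> space M. \<not> almost_isometric \<epsilon> W (g (X \<omega>)) (f (X \<omega>))} \<in> sets M"
    using * by (rule sets.sets_Collect_neg)
qed

text \<open>Images of a \<open>d\<close>-dimensional subspace may have smaller dimension; the defining bound reaches them
  through a \<open>d\<close>-dimensional superspace.\<close>

lemma (in prob_space) embedding_failure_le: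
  fixes A :: "'a \<Rightarrow> real^'q^'k" and V :: "(real^'q) set"
  assumes ose: "oblivious_subspace_embedding M (\<lambda>\<omega> x. A \<omega> *v x) \<epsilon> \<delta> d"
    and A: "A \<in> borel_measurable M" and V: "subspace V" "dim V \<le> d"
  shows "prob {\<omega> \<in> space M. \<not> almost_isometric \<epsilon> V (\<lambda>x. x) (\<lambda>x. A \<omega> *v x)} \<le> \<delta>"
proof -
  have d: "d \<le> DIM(real^'q)"
    using ose by (simp add: oblivious_subspace_embedding_def)
  obtain Z where Z: "subspace Z" "dim Z = d" "V \<subseteq> Z"
    using subspace_superset_of_dim[OF V d] by blast
  note meas = almost_isometric_measurable[where f = "\<lambda>A x. A *v x" and g = "\<lambda>A x. x" and X = A,
      OF _ _ A]
  have "1 - \<delta> \<le> prob {\<omega> \<in> space M. almost_isometric \<epsilon> Z (\<lambda>x. x) (\<lambda>x. A \<omega> *v x)}"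
    using ose Z unfolding oblivious_subspace_embedding_def almost_isometric_def by blast
  then have "prob {\<omega> \<in> space M. \<not> almost_isometric \<epsilon> Z (\<lambda>x. x) (\<lambda>x. A \<omega> *v x)} \<le> \<delta>"
    by (subst (asm) prob_ge_iff_complement_le) (intro meas continuous_intros | assumption)+
  moreover have "prob {\<omega> \<in> space M. \<not> almost_isometric \<epsilon> V (\<lambda>x. x) (\<lambda>x. A \<omega> *v x)}
      \<le> prob {\<omega> \<in> space M. \<not> almost_isometric \<epsilon> Z (\<lambda>x. x) (\<lambda>x. A \<omega> *v x)}"
    using Z(3) by (intro finite_measure_mono meas continuous_intros) (auto dest: almost_isometric_mono)
  ultimately show ?thesis by simp
qed

text \<open>Double counting over pairs of an outcome \<open>\<omega>\<close> and a sign vector \<open>s\<close> for which \<open>A \<omega>\<close> distorts the subspace \<open>W s\<close>. For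
  each \<open>s\<close> this is unlikely, because \<open>W s\<close> is a fixed subspace of dimension at most \<open>d\<close>; for each
  outcome that distorts \<open>W\<close> it happens for at least a fraction \<open>1 / 240\<close> of the \<open>s\<close>.\<close>

lemma (in prob_space) matrix_embedding_failure_le:
  fixes A :: "'a \<Rightarrow> real^'q^'k" and W :: "(real^'n^'q) set"
  assumes ose: "oblivious_subspace_embedding M (\<lambda>\<omega> x. A \<omega> *v x) \<epsilon> \<delta> d"
    and A: "A \<in> borel_measurable M" and W: "subspace W" "dim W \<le> d"
  shows "prob {\<omega> \<in> space M. \<not> almost_isometric \<epsilon> W (\<lambda>X. X) (\<lambda>X. A \<omega> ** X)} \<le> 240 * \<delta>"
    (is "prob ?Bad \<le> _")
proof -
  define bad where "bad T = {\<omega> \<in> space M.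
    \<not> almost_isometric \<epsilon> ((\<lambda>X. X *v sign_vector T) ` W) (\<lambda>x. x) (\<lambda>x. A \<omega> *v x)}" for T :: "'n set"
  have bad_sets: "bad T \<in> events" for T
    unfolding bad_def
    by (rule almost_isometric_measurable[where f = "\<lambda>A x. A *v x" and g = "\<lambda>A x. x" and X = A,
          OF _ _ A]) (intro continuous_intros)+
  have Bad_sets: "?Bad \<in> events"
    by (rule almost_isometric_measurable[where f = "\<lambda>A x. A ** x" and g = "\<lambda>A x. x" and X = A,
          OF _ _ A]) (intro continuous_intros)+
  have prob_bad: "prob (bad T) \<le> \<delta>" for T
    unfolding bad_def
  proof (rule embedding_failure_le[OF ose A])
    show "subspace ((\<lambda>X. X *v sign_vector T) ` W)"
      by (rule linear_subspace_image[OF linear_matrix_vector_mult_left W(1)])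
    show "dim ((\<lambda>X. X *v sign_vector T) ` W) \<le> d"
      using dim_image_le[OF linear_matrix_vector_mult_left, of "sign_vector T" W] W(2) by simp
  qed
  have integrable: "integrable M (indicat_real ?Bad)" "integrable M (indicat_real (bad T))" for T
    using Bad_sets bad_sets[of T] by (simp_all add: integrable_real_indicator emeasure_eq_measure)
  have pointwise: "2 ^ CARD('n) * indicat_real ?Bad \<omega> \<le> (\<Sum>T\<in>UNIV. 240 * indicat_real (bad T) \<omega>)" for \<omega>
  proof (cases "\<omega> \<in> ?Bad")
    case True
    then have "2 ^ CARD('n) \<le> 240 * real (card {T. \<omega> \<in> bad T})"
      using distorted_sign_fraction[OF W(1), of \<epsilon> "A \<omega>"] by (simp add: bad_def)
    also have "\<dots> = (\<Sum>T\<in>UNIV. 240 * indicat_real (bad T) \<omega>)"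
      by (simp add: indicator_def sum.If_cases flip: sum_distrib_left)
    finally show ?thesis using True by simp
  next
    case False
    then show ?thesis by (simp add: sum_nonneg)
  qed
  have "2 ^ CARD('n) * prob ?Bad = expectation (\<lambda>\<omega>. 2 ^ CARD('n) * indicat_real ?Bad \<omega>)"
    using Bad_sets by simp
  also have "\<dots> \<le> expectation (\<lambda>\<omega>. \<Sum>T\<in>UNIV. 240 * indicat_real (bad T) \<omega>)"
    by (intro integral_mono pointwise Bochner_Integration.integrable_sum integrable_mult_right integrable)
  also have "\<dots> = (\<Sum>T\<in>UNIV. 240 * prob (bad T))"
    using bad_sets by (subst Bochner_Integration.integral_sum) (auto intro: integrable)
  also have "\<dots> \<le> (\<Sum>T\<in>(UNIV :: 'n set set). 240 * \<delta>)"
    using prob_bad by (intro sum_mono) simp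
  also have "\<dots> = 2 ^ CARD('n) * (240 * \<delta>)"
    using card_Pow[of "UNIV :: 'n set"] by simp
  finally show ?thesis by simp
qed

section \<open>Independent stages\<close>

text \<open>This is the characterisation of independence by the joint law, for two random variables whose
  codomains are different types.\<close>

lemma (in prob_space) distr_Pair_indep_vimage_algebras:
  assumes [measurable]: "random_variable S X" "random_variable T Y"
    and ind: "indep_set (sets (vimage_algebra (space M) X S)) (sets (vimage_algebra (space M) Y T))"
  shows "distr M S X \<Otimes>\<^sub>M distr M T Y = distr M (S \<Otimes>\<^sub>M T) (\<lambda>\<omega>. (X \<omega>, Y \<omega>))"
proof -
  interpret X: prob_space "distr M S X" by (rule prob_space_distr) measurable
  interpret Y: prob_space "distr M T Y" by (rule prob_space_distr) measurable
  show ?thesis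
  proof (rule pair_measure_eqI)
    show "sigma_finite_measure (distr M S X)" "sigma_finite_measure (distr M T Y)" ..
    fix A B assume "A \<in> sets (distr M S X)" "B \<in> sets (distr M T Y)"
    then have A [measurable]: "A \<in> sets S" and B [measurable]: "B \<in> sets T" by simp_all
    have "emeasure (distr M (S \<Otimes>\<^sub>M T) (\<lambda>\<omega>. (X \<omega>, Y \<omega>))) (A \<times> B)
        = emeasure M ((\<lambda>\<omega>. (X \<omega>, Y \<omega>)) -` (A \<times> B) \<inter> space M)"
      by (rule emeasure_distr) measurable
    also have "(\<lambda>\<omega>. (X \<omega>, Y \<omega>)) -` (A \<times> B) \<inter> space M = (X -` A \<inter> space M) \<inter> (Y -` B \<inter> space M)"
      by auto
    also have "emeasure M \<dots> = emeasure M (X -` A \<inter> space M) * emeasure M (Y -` B \<inter> space M)"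
      using indep_setD[OF ind in_vimage_algebra[OF A] in_vimage_algebra[OF B]]
      by (simp add: emeasure_eq_measure ennreal_mult)
    also have "\<dots> = emeasure (distr M S X) A * emeasure (distr M T Y) B"
      by (simp add: emeasure_distr)
    finally show "emeasure (distr M S X) A * emeasure (distr M T Y) B
        = emeasure (distr M (S \<Otimes>\<^sub>M T) (\<lambda>\<omega>. (X \<omega>, Y \<omega>))) (A \<times> B)" by simp
  qed simp
qed

text \<open>Conditioning on \<open>X\<close>: by Fubini a bound that holds for every frozen value of \<open>X\<close> holds for the pair.\<close>

lemma (in prob_space) indep_failure_le:
  assumes rv [measurable]: "random_variable S X" "random_variable T Y"
    and ind: "indep_set (sets (vimage_algebra (space M) X S)) (sets (vimage_algebra (space M) Y T))"
    and B: "B \<in> sets (S \<Otimes>\<^sub>M T)"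
    and le: "\<And>x. x \<in> space S \<Longrightarrow> prob {\<omega> \<in> space M. (x, Y \<omega>) \<in> B} \<le> \<eta>"
  shows "prob {\<omega> \<in> space M. (X \<omega>, Y \<omega>) \<in> B} \<le> \<eta>"
proof -
  interpret X: prob_space "distr M S X" by (rule prob_space_distr) measurable
  interpret Y: prob_space "distr M T Y" by (rule prob_space_distr) measurable
  obtain \<omega>0 where "\<omega>0 \<in> space M" using not_empty by blast
  then have "0 \<le> \<eta>"
    using order_trans[OF measure_nonneg le] measurable_space[OF rv(1)] by blast
  have sect: "emeasure (distr M T Y) (Pair x -` B) \<le> ennreal \<eta>" if "x \<in> space S" for x
  proof -
    have "emeasure (distr M T Y) (Pair x -` B) = emeasure M (Y -` (Pair x -` B) \<inter> space M)"
      using sets_Pair1[OF B] by (intro emeasure_distr) auto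
    also have "Y -` (Pair x -` B) \<inter> space M = {\<omega> \<in> space M. (x, Y \<omega>) \<in> B}" by auto
    finally show ?thesis
      using le[OF that] by (simp add: emeasure_eq_measure ennreal_leI)
  qed
  have "emeasure M {\<omega> \<in> space M. (X \<omega>, Y \<omega>) \<in> B} = emeasure M ((\<lambda>\<omega>. (X \<omega>, Y \<omega>)) -` B \<inter> space M)"
    by (rule arg_cong[where f = "emeasure M"]) auto
  also have "\<dots> = emeasure (distr M (S \<Otimes>\<^sub>M T) (\<lambda>\<omega>. (X \<omega>, Y \<omega>))) B"
    using B by (intro emeasure_distr[symmetric]) measurable
  also have "\<dots> = emeasure (distr M S X \<Otimes>\<^sub>M distr M T Y) B"
    by (simp add: distr_Pair_indep_vimage_algebras[OF rv ind])
  also have "\<dots> = (\<integral>\<^sup>+x. emeasure (distr M T Y) (Pair x -` B) \<partial>distr M S X)"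
    using B by (intro Y.emeasure_pair_measure_alt) simp
  also have "\<dots> \<le> (\<integral>\<^sup>+x. ennreal \<eta> \<partial>distr M S X)"
    using sect by (intro nn_integral_mono) simp
  also have "\<dots> = ennreal \<eta>"
    using X.emeasure_space_1 by simp
  finally show ?thesis
    using \<open>0 \<le> \<eta>\<close> by (simp add: emeasure_eq_measure)
qed

text \<open>The stages are decoupled one at a time: the second argument is independent of the first, and the pair
  of both is independent of the third. For the pair, the sigma-algebra that it generates lies in the one
  generated by both of its components together.\<close>

lemma (in prob_space) indep_vars3_imp_indep_set:
  assumes "indep_vars3 N1 X1 N2 X2 N3 X3"
  shows "indep_set (sets (vimage_algebra (space M) X2 N2)) (sets (vimage_algebra (space M) X1 N1))"
    and "indep_set (sets (vimage_algebra (space M) (\<lambda>\<omega>. (X2 \<omega>, X1 \<omega>)) (N2 \<Otimes>\<^sub>M N1)))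
      (sets (vimage_algebra (space M) X3 N3))"
proof -
  define G1 where "G1 = sets (vimage_algebra (space M) X1 N1)"
  define G2 where "G2 = sets (vimage_algebra (space M) X2 N2)"
  define G3 where "G3 = sets (vimage_algebra (space M) X3 N3)"
  have rv: "random_variable N1 X1" "random_variable N2 X2" "random_variable N3 X3"
    and ind: "indep_sets (\<lambda>i::nat. [G1, G2, G3] ! i) {0, 1, 2}"
    using assms by (simp_all add: indep_vars3_def G1_def G2_def G3_def)
  have ind12: "indep_sets (\<lambda>i::nat. [G1, G2, G3] ! i) {0, 1}"
    using ind by (rule indep_sets_mono_index[rotated]) auto
  have "indep_set G2 G1"
  proof (rule indep_setI)
    show "G2 \<subseteq> events" "G1 \<subseteq> events"
      using ind12 by (auto simp: indep_sets_def)
    fix a b assume "a \<in> G2" "b \<in> G1"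
    then show "prob (a \<inter> b) = prob a * prob b"
      using indep_setsD[OF ind12, of "{0, 1}" "\<lambda>i. [b, a] ! i"] by (simp add: Int_commute)
  qed
  then show "indep_set (sets (vimage_algebra (space M) X2 N2)) (sets (vimage_algebra (space M) X1 N1))"
    by (simp add: G1_def G2_def)

  have stable: "Int_stable G1" "Int_stable G2" "Int_stable G3"
    by (auto simp: G1_def G2_def G3_def Int_stable_def)
  have joint: "indep_sets (\<lambda>j. sigma_sets (space M) (\<Union>i\<in>(if j then {0, 1} else {2}). [G1, G2, G3] ! i)) UNIV"
  proof (rule indep_sets_collect_sigma)
    have "(\<Union>j::bool. if j then {0, 1} else {2 :: nat}) = {0, 1, 2}"
      by (auto simp: UNIV_bool)
    then show "indep_sets (\<lambda>i::nat. [G1, G2, G3] ! i) (\<Union>j::bool. if j then {0, 1} else {2})"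
      using ind by simp
    show "disjoint_family (\<lambda>j::bool. if j then {0, 1} else {2 :: nat})"
      by (auto simp: disjoint_family_on_def)
  qed (use stable in \<open>auto split: if_splits\<close>)
  have G_space: "G1 \<union> G2 \<subseteq> Pow (space M)"
    using sets.space_closed[of "vimage_algebra (space M) X1 N1"]
      sets.space_closed[of "vimage_algebra (space M) X2 N2"]
    by (simp add: G1_def G2_def)
  have pair: "(\<lambda>\<omega>. (X2 \<omega>, X1 \<omega>)) \<in> measurable (sigma (space M) (G1 \<union> G2)) (N2 \<Otimes>\<^sub>M N1)"
  proof (rule measurable_Pair)
    show "X2 \<in> measurable (sigma (space M) (G1 \<union> G2)) N2"
      using rv G_space
      by (intro measurableI) (auto simp: G2_def intro!: sigma_sets.Basic in_vimage_algebra dest: measurable_space)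
    show "X1 \<in> measurable (sigma (space M) (G1 \<union> G2)) N1"
      using rv G_space
      by (intro measurableI) (auto simp: G1_def intro!: sigma_sets.Basic in_vimage_algebra dest: measurable_space)
  qed
  have "indep_sets (case_bool
      (sets (vimage_algebra (space M) (\<lambda>\<omega>. (X2 \<omega>, X1 \<omega>)) (N2 \<Otimes>\<^sub>M N1))) G3) UNIV"
  proof (rule indep_sets_mono_sets[OF joint])
    fix j :: bool
    have "sets (vimage_algebra (space M) (\<lambda>\<omega>. (X2 \<omega>, X1 \<omega>)) (N2 \<Otimes>\<^sub>M N1))
        \<subseteq> sigma_sets (space M) (G1 \<union> G2)"
      unfolding sets_vimage_algebra
      using measurable_sets[OF pair] G_space by (intro sigma_sets_mono) (auto simp: space_measure_of_conv)
    moreover have "G3 \<subseteq> sigma_sets (space M) G3"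
      by (auto intro: sigma_sets.Basic)
    ultimately show "(case j of
        True \<Rightarrow> sets (vimage_algebra (space M) (\<lambda>\<omega>. (X2 \<omega>, X1 \<omega>)) (N2 \<Otimes>\<^sub>M N1)) | False \<Rightarrow> G3)
      \<subseteq> sigma_sets (space M) (\<Union>i\<in>(if j then {0, 1} else {2}). [G1, G2, G3] ! i)"
      by (cases j) auto
  qed
  then show "indep_set (sets (vimage_algebra (space M) (\<lambda>\<omega>. (X2 \<omega>, X1 \<omega>)) (N2 \<Otimes>\<^sub>M N1)))
      (sets (vimage_algebra (space M) X3 N3))"
    by (simp add: indep_set_def G3_def)
qed

section \<open>Composing the three embeddings\<close>

text \<open>Both factors under the ceiling are controlled from below, by \<open>25200\<close> and \<open>1\<close>, so that \<open>\<delta>'\<close> is at most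
  \<open>\<delta> / 25200\<close> and the factor \<open>240\<close> lost by the sign vectors is affordable.\<close>

lemma embedding_probability_le:
  fixes \<epsilon> \<delta> :: real
  assumes "0 < d" "0 < \<epsilon>" "\<epsilon> < 1" "0 < \<delta>" "\<delta> < 1"
  shows "240 * (\<delta> / real_of_int \<lceil>25200 / \<epsilon>\<^sup>2 * (6.9 * eta K * real d + ln (24 / \<delta>))\<rceil>) \<le> \<delta> / 3"
proof -
  define c where "c = 25200 / \<epsilon>\<^sup>2 * (6.9 * eta K * real d + ln (24 / \<delta>))"
  have "1 \<le> eta K" by (cases K) auto
  then have "1 * 1 \<le> eta K * real d" using assms by (intro mult_mono) auto
  moreover have "0 \<le> ln (24 / \<delta>)" using assms by simp
  ultimately have 1: "1 \<le> 6.9 * eta K * real d + ln (24 / \<delta>)" by simp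
  have "\<epsilon>\<^sup>2 \<le> 1" using assms by (simp add: power_le_one)
  then have 2: "25200 \<le> 25200 / \<epsilon>\<^sup>2" using assms by (simp add: field_simps)
  have "25200 * 1 \<le> c"
    unfolding c_def using 1 2 by (intro mult_mono) auto
  also have "c \<le> real_of_int \<lceil>c\<rceil>" by (rule le_of_int_ceiling)
  finally have "720 \<le> real_of_int \<lceil>c\<rceil>" by simp
  then show ?thesis
    using assms unfolding c_def[symmetric] by (simp add: field_simps)
qed

lemma composed_distortion_le:
  fixes \<epsilon> :: real
  assumes "0 < \<epsilon>" "\<epsilon> < 1"
  shows "(1 + ((1 + \<epsilon> / 5) * (1 + \<epsilon> / 5) - 1)) * (1 + \<epsilon> / 4) - 1 \<le> \<epsilon>"
proof -
  have "\<epsilon> ^ 2 \<le> \<epsilon> ^ 1" "\<epsilon> ^ 3 \<le> \<epsilon> ^ 1"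
    using assms by (intro power_decreasing; simp)+
  moreover have "(1 + ((1 + \<epsilon> / 5) * (1 + \<epsilon> / 5) - 1)) * (1 + \<epsilon> / 4) - 1
      = (65 * \<epsilon> + 14 * \<epsilon> ^ 2 + \<epsilon> ^ 3) / 100"
    by (simp add: field_simps power2_eq_square power3_eq_cube)
  ultimately show ?thesis using assms by simp
qed

theorem proposition3p6:
  fixes M :: "'w measure"
    and \<Sigma> :: "'w \<Rightarrow> real^'p^'k\<^sub>\<Sigma>"
    and \<Omega> :: "'w \<Rightarrow> real^'q^'k\<^sub>\<Omega>"
    and \<Gamma> :: "'w \<Rightarrow> real^('k\<^sub>\<Sigma> \<times> 'k\<^sub>\<Omega>)^'k"
    and \<epsilon> \<delta> \<epsilon>' \<delta>' :: real and d :: nat and K :: scalars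
  assumes "prob_space M"
    and "0 < d"
    and "0 < \<epsilon>" "\<epsilon> < 1" "0 < \<delta>" "\<delta> < 1"
    and "\<epsilon>' = \<epsilon> / 5"
    and "\<delta>' = \<delta> / real_of_int \<lceil>25200 / \<epsilon>\<^sup>2 * (6.9 * eta K * real d + ln (24 / \<delta>))\<rceil>"
    and "oblivious_subspace_embedding M (\<lambda>\<omega> x. \<Sigma> \<omega> *v x) \<epsilon>' \<delta>' d"
    and "oblivious_subspace_embedding M (\<lambda>\<omega> x. \<Omega> \<omega> *v x) \<epsilon>' \<delta>' d"
    and "oblivious_subspace_embedding M (\<lambda>\<omega> x. \<Gamma> \<omega> *v x) (\<epsilon> / 4) (\<delta> / 3) d"
    and "prob_space.indep_vars3 M borel \<Sigma> borel \<Omega> borel \<Gamma>"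
  shows "oblivious_subspace_embedding M
           (\<lambda>\<omega> (X :: real^'p^'q). \<Gamma> \<omega> *v vec_cols (\<Omega> \<omega> ** X ** transpose (\<Sigma> \<omega>))) \<epsilon> \<delta> d"
proof -
  interpret prob_space M by fact
  note \<Sigma>_ose = assms(9) and \<Omega>_ose = assms(10) and \<Gamma>_ose = assms(11)
  note indep = indep_vars3_imp_indep_set[OF assms(12)]
  have meas [measurable]: "\<Sigma> \<in> borel_measurable M" "\<Omega> \<in> borel_measurable M" "\<Gamma> \<in> borel_measurable M"
    using assms(12) by (simp_all add: indep_vars3_def)
  have \<delta>': "240 * \<delta>' \<le> \<delta> / 3"
    unfolding assms(8) using embedding_probability_le assms(2-6) by blast
  define \<Upsilon> where "\<Upsilon> \<omega> X = \<Gamma> \<omega> *v vec_cols (\<Omega> \<omega> ** X ** transpose (\<Sigma> \<omega>))" for \<omega> and X :: "real^'p^'q"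
  have joint_meas: "(\<lambda>\<omega>. (\<Omega> \<omega>, \<Sigma> \<omega>)) \<in> borel_measurable M"
      "(\<lambda>\<omega>. ((\<Omega> \<omega>, \<Sigma> \<omega>), \<Gamma> \<omega>)) \<in> borel_measurable M"
    by (intro borel_measurable_Pair meas)+
  have pair_meas: "(\<lambda>\<omega>. (\<Omega> \<omega>, \<Sigma> \<omega>)) \<in> measurable M (borel \<Otimes>\<^sub>M borel)"
    by measurable

  have linear_\<Upsilon>: "linear (\<Upsilon> \<omega>)" for \<omega>
  proof -
    have "\<Upsilon> \<omega> = (\<lambda>x. \<Gamma> \<omega> *v x) \<circ> vec_cols \<circ> (\<lambda>X. X ** transpose (\<Sigma> \<omega>)) \<circ> (\<lambda>X. \<Omega> \<omega> ** X)"
      by (simp add: \<Upsilon>_def fun_eq_iff)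
    then show ?thesis
      by (simp only:) (intro linear_compose linear_matrix_mult_right linear_matrix_mult_left
          linear_vec_cols matrix_vector_mul_linear)
  qed
  have \<Upsilon>_meas: "(\<lambda>\<omega>. \<Upsilon> \<omega> X) \<in> borel_measurable M" for X
  proof -
    have "continuous_on UNIV (\<lambda>((A :: real^'q^'k\<^sub>\<Omega>, S :: real^'p^'k\<^sub>\<Sigma>), G :: real^('k\<^sub>\<Sigma> \<times> 'k\<^sub>\<Omega>)^'k).
        G *v vec_cols (A ** X ** transpose S))"
      unfolding case_prod_unfold by (intro continuous_intros)
    from measurable_compose[OF joint_meas(2) borel_measurable_continuous_onI[OF this]]
    show ?thesis by (simp add: \<Upsilon>_def)
  qed

  have "1 - \<delta> \<le> prob {\<omega> \<in> space M. almost_isometric \<epsilon> W (\<lambda>X. X) (\<Upsilon> \<omega>)}"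
    if W: "subspace W" "dim W = d" for W :: "(real^'p^'q) set"
  proof -
    (* One event per stage: each compares the stage's output with its input, pulled back to W. *)
    define Bad1 where "Bad1 = {\<omega> \<in> space M. \<not> almost_isometric \<epsilon>' W (\<lambda>X. X) (\<lambda>X. \<Omega> \<omega> ** X)}"
    define bad2 :: "((real^'q^'k\<^sub>\<Omega>) \<times> (real^'p^'k\<^sub>\<Sigma>)) set"
      where "bad2 = {p. \<not> almost_isometric \<epsilon>' W (\<lambda>X. fst p ** X) (\<lambda>X. fst p ** X ** transpose (snd p))}"
    define Bad2 where "Bad2 = {\<omega> \<in> space M. (\<Omega> \<omega>, \<Sigma> \<omega>) \<in> bad2}"
    define bad3 :: "(((real^'q^'k\<^sub>\<Omega>) \<times> (real^'p^'k\<^sub>\<Sigma>)) \<times> (real^('k\<^sub>\<Sigma> \<times> 'k\<^sub>\<Omega>)^'k)) set"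
      where "bad3 = {p. \<not> almost_isometric (\<epsilon> / 4) W
        (\<lambda>X. fst (fst p) ** X ** transpose (snd (fst p)))
        (\<lambda>X. snd p *v vec_cols (fst (fst p) ** X ** transpose (snd (fst p))))}"
    define Bad3 where "Bad3 = {\<omega> \<in> space M. ((\<Omega> \<omega>, \<Sigma> \<omega>), \<Gamma> \<omega>) \<in> bad3}"

    have bad2: "bad2 \<in> sets (borel \<Otimes>\<^sub>M borel)"
      unfolding borel_prod bad2_def Collect_neg_eq
      by (intro borel_comp borel_closed closed_almost_isometric continuous_intros)
    have bad3: "bad3 \<in> sets ((borel \<Otimes>\<^sub>M borel) \<Otimes>\<^sub>M borel)"
      unfolding borel_prod bad3_def Collect_neg_eq
      by (intro borel_comp borel_closed closed_almost_isometric continuous_intros)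
    have events: "Bad1 \<in> events" "Bad2 \<in> events" "Bad3 \<in> events"
    proof -
      show "Bad1 \<in> events"
        unfolding Bad1_def
        by (rule almost_isometric_measurable[where f = "\<lambda>A x. A ** x" and g = "\<lambda>A x. x" and X = \<Omega>,
              OF _ _ meas(2)]) (intro continuous_intros)+
      show "Bad2 \<in> events"
        using bad2 unfolding Bad2_def by measurable
      show "Bad3 \<in> events"
        using bad3 unfolding Bad3_def by measurable
    qed

    have "prob Bad1 \<le> \<delta> / 3"
      using matrix_embedding_failure_le[OF \<Omega>_ose meas(2) W(1)] W(2) \<delta>' by (simp add: Bad1_def)
    moreover have "prob Bad2 \<le> \<delta> / 3"
      unfolding Bad2_def
    \<comment> \<open>With \<open>\<Omega>\<close> frozen at \<open>A\<close>, transposition turns right multiplication on \<open>A W\<close> into left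
      multiplication by \<open>\<Sigma>\<close> on the space \<open>V\<close> of transposed matrices.\<close>
    proof (rule indep_failure_le[OF meas(2,1) indep(1) bad2])
      fix A :: "real^'q^'k\<^sub>\<Omega>"
      define V where "V = (\<lambda>X. transpose (A ** X)) ` W"
      have lin: "linear (\<lambda>X :: real^'p^'q. transpose (A ** X))"
        using linear_compose[OF linear_matrix_mult_right linear_transpose] by (simp add: o_def)
      have V: "subspace V" "dim V \<le> d"
        unfolding V_def using linear_subspace_image[OF lin W(1)] dim_image_le[OF lin, of W] W(2) by auto
      have "almost_isometric \<epsilon>' V (\<lambda>X. X) (\<lambda>X. S ** X) \<longleftrightarrow> (A, S) \<notin> bad2" for S
      proof -
        have "S ** transpose (A ** X) = transpose (A ** X ** transpose S)" for X :: "real^'p^'q"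
          by (simp add: matrix_transpose_mul)
        then show ?thesis
          by (simp add: V_def bad2_def almost_isometric_image almost_isometric_def inner_transpose norm_transpose)
      qed
      then show "prob {\<omega> \<in> space M. (A, \<Sigma> \<omega>) \<in> bad2} \<le> \<delta> / 3"
        using matrix_embedding_failure_le[OF \<Sigma>_ose meas(1) V] \<delta>' by simp
    qed
    moreover have "prob Bad3 \<le> \<delta> / 3"
      unfolding Bad3_def
    proof (rule indep_failure_le[OF pair_meas meas(3) indep(2) bad3])
      fix p :: "(real^'q^'k\<^sub>\<Omega>) \<times> (real^'p^'k\<^sub>\<Sigma>)"
      define V where "V = (\<lambda>X. vec_cols (fst p ** X ** transpose (snd p))) ` W"
      have lin: "linear (\<lambda>X :: real^'p^'q. vec_cols (fst p ** X ** transpose (snd p)))"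
        using linear_compose[OF linear_compose[OF linear_matrix_mult_right linear_matrix_mult_left] linear_vec_cols]
        by (simp add: o_def)
      have V: "subspace V" "dim V \<le> d"
        unfolding V_def using linear_subspace_image[OF lin W(1)] dim_image_le[OF lin, of W] W(2) by auto
      have "almost_isometric (\<epsilon> / 4) V (\<lambda>x. x) (\<lambda>x. G *v x) \<longleftrightarrow> (p, G) \<notin> bad3" for G
        by (simp add: V_def bad3_def almost_isometric_image almost_isometric_def inner_vec_cols norm_vec_cols)
      then show "prob {\<omega> \<in> space M. (p, \<Gamma> \<omega>) \<in> bad3} \<le> \<delta> / 3"
        using embedding_failure_le[OF \<Gamma>_ose meas(3) V] by simp
    qed
    ultimately have "prob (Bad1 \<union> Bad2 \<union> Bad3) \<le> \<delta>"
      using measure_Un_le[of "Bad1 \<union> Bad2" M Bad3] measure_Un_le[of Bad1 M Bad2] events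
      by simp
    moreover have good: "{\<omega> \<in> space M. almost_isometric \<epsilon> W (\<lambda>X. X) (\<Upsilon> \<omega>)} \<in> events"
      unfolding \<Upsilon>_def
      using almost_isometric_measurable(1)[where
          f = "\<lambda>p X. snd p *v vec_cols (fst (fst p) ** X ** transpose (snd (fst p)))"
          and g = "\<lambda>p X. X", OF _ _ joint_meas(2)]
      by (simp add: continuous_intros)
    moreover have "{\<omega> \<in> space M. \<not> almost_isometric \<epsilon> W (\<lambda>X. X) (\<Upsilon> \<omega>)} \<subseteq> Bad1 \<union> Bad2 \<union> Bad3"
    proof (rule subsetI, rule ccontr)
      fix \<omega> assume bad: "\<omega> \<in> {\<omega> \<in> space M. \<not> almost_isometric \<epsilon> W (\<lambda>X. X) (\<Upsilon> \<omega>)}"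
        and "\<omega> \<notin> Bad1 \<union> Bad2 \<union> Bad3"
      then have 1: "almost_isometric (\<epsilon> / 5) W (\<lambda>X. X) (\<lambda>X. \<Omega> \<omega> ** X)"
        and 2: "almost_isometric (\<epsilon> / 5) W (\<lambda>X. \<Omega> \<omega> ** X) (\<lambda>X. \<Omega> \<omega> ** X ** transpose (\<Sigma> \<omega>))"
        and 3: "almost_isometric (\<epsilon> / 4) W (\<lambda>X. \<Omega> \<omega> ** X ** transpose (\<Sigma> \<omega>)) (\<Upsilon> \<omega>)"
        by (auto simp: Bad1_def Bad2_def Bad3_def bad2_def bad3_def \<Upsilon>_def[abs_def] assms(7))
      have "0 \<le> (1 + \<epsilon> / 5) * (1 + \<epsilon> / 5) - 1"
        using assms(3) by (simp add: algebra_simps)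
      then have "almost_isometric \<epsilon> W (\<lambda>X. X) (\<Upsilon> \<omega>)"
        using almost_isometric_trans[OF almost_isometric_trans[OF 1 2] 3] composed_distortion_le assms(3,4)
        by (auto intro: almost_isometric_weaken)
      then show False using bad by simp
    qed
    ultimately show ?thesis
      unfolding prob_ge_iff_complement_le[OF good]
      using events finite_measure_mono order_trans by (meson sets.Un)
  qed
  moreover have "1 \<le> d" "d \<le> DIM(real^'p^'q)"
  proof -
    have "d \<le> CARD('p)" using \<Sigma>_ose by (simp add: oblivious_subspace_embedding_def)
    also have "\<dots> \<le> CARD('p) * CARD('q)" by simp
    finally show "d \<le> DIM(real^'p^'q)" by (simp add: mult.commute)
    show "1 \<le> d" using assms(2) by simp
  qed
  ultimately show ?thesis
    using linear_\<Upsilon> \<Upsilon>_meas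
    unfolding oblivious_subspace_embedding_def random_linear_map_def \<Upsilon>_def almost_isometric_def by blast
qed

end
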